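(* Suppose that $\mathcal{L}(\mathscr{D}_k,h_k)\le\epsilon$ for all $k\in\{1,\dots,p\}$, that $L(h_k(x),y)\le M$ for all $k$ and all $(x,y)\in\mathcal{X}\times\mathcal{Y}$, and that the conditional probability $\mathscr{D}_k(y|x)$ does not depend on $k$, for any $(x,y)$. For each $k$, let $\widehat{\mathscr{D}}_k$ be an estimate of $\mathscr{D}_k$. Let $\mathscr{D}_T$ be an arbitrary (target) distribution on $\mathcal{X}\times\mathcal{Y}$. Then, for any $\delta>0$, there exist $\eta>0$ and $z\in\Delta$ such that the following inequality holds for any $\alpha>1$: $$\mathcal{L}(\mathscr{D}_T,\widehat h_z^\eta)\le\Big[(\widehat\epsilon+\delta)\,\mathsf{d}_\alpha(\mathscr{D}_T\parallel\widehat{\mathcal{D}})\Big]^{\frac{\alpha-1}{\alpha}}M^{\frac1\alpha},$$ where $$\widehat\epsilon=\max_{k\in\{1,\dots,p\}}\Big[\epsilon\,\mathsf{d}_\alpha(\widehat{\mathscr{D}}_k\parallel\mathscr{D}_k)\Big]^{\frac{\alpha-1}{\alpha}}M^{\frac1\alpha},\qquad \widehat{\mathcal{D}}=\Big\{\sum_{k=1}^p\lambda_k\widehat{\mathscr{D}}_k:\lambda\in\Delta\Big\}.$$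
   Context: Setting: $\mathcal{X}$ is a finite input space and $\mathcal{Y}\subseteq\mathbb{R}$ is an output space, convex so that convex combinations of predictor values are again valid predictions. Distributions on $\mathcal{X}\times\mathcal{Y}$ are discrete, and expectations are written as sums. $\mathscr{U}^1$ is the uniform distribution on $\mathcal{X}$. $L:\mathcal{Y}\times\mathcal{Y}\to\mathbb{R}_+$ is a loss function that is convex and continuous. For a distribution $\mathscr{D}$ on $\mathcal{X}\times\mathcal{Y}$ and a predictor $h:\mathcal{X}\to\mathcal{Y}$, the expected loss is $\mathcal{L}(\mathscr{D},h)=\sum_{(x,y)}\mathscr{D}(x,y)L(h(x),y)$, and $\mathscr{D}^1(x)=\sum_{y}\mathscr{D}(x,y)$ is the marginal on $\mathcal{X}$ (similarly $\widehat{\mathscr{D}}^1$ for $\widehat{\mathscr{D}}$). There are $p\ge1$ source distributions $\mathscr{D}_1,\dots,\mathscr{D}_p$ on $\mathcal{X}\times\mathcal{Y}$, with estimates $\widehat{\mathscr{D}}_1,\dots,\widehat{\mathscr{D}}_p$ (also probability distributions on $\mathcal{X}\times\mathcal{Y}$), and predictors $h_k:\mathcal{X}\to\mathcal{Y}$, $k=1,\dots,p$; $\epsilon>0$ and $M\ge0$ are constants. $\Delta=\{\lambda\in\mathbb{R}^p:\lambda_k\ge0\ \forall k,\ \sum_{k=1}^p\lambda_k=1\}$. For $z\in\Delta$ and $\eta>0$, the distribution-weighted combination based on the estimates is $$\widehat h_z^\eta(x)=\sum_{k=1}^p\frac{z_k\widehat{\mathscr{D}}_k^1(x)+\eta\,\mathscr{U}^1(x)/p}{\sum_{j=1}^pz_j\widehat{\mathscr{D}}_j^1(x)+\eta\,\mathscr{U}^1(x)}\,h_k(x).$$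 For $\alpha>1$ and distributions $\mathscr{D},\mathscr{D}'$ on $\mathcal{X}\times\mathcal{Y}$, the exponential of the $\alpha$-Rényi divergence is $\mathsf{d}_\alpha(\mathscr{D}\parallel\mathscr{D}')=\Big[\sum_{(x,y)}\frac{\mathscr{D}(x,y)^\alpha}{\mathscr{D}'(x,y)^{\alpha-1}}\Big]^{\frac1{\alpha-1}}$, where terms with $\mathscr{D}(x,y)=0$ are $0$ and terms with $\mathscr{D}(x,y)>0=\mathscr{D}'(x,y)$ are $+\infty$. For a class of distributions $\mathcal{C}$, $\mathsf{d}_\alpha(\mathscr{D}\parallel\mathcal{C})=\inf_{\mathscr{D}'\in\mathcal{C}}\mathsf{d}_\alpha(\mathscr{D}\parallel\mathscr{D}')$. Note that $\widehat\epsilon$ depends on $\alpha$. If one of the divergences involved is $+\infty$, the inequality is regarded as trivially true.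
   Formalization: The formal theorem also assumes that the conditional probabilities of the estimates $\widehat{\mathscr{D}}_k(y|x)$ agree across $k$ wherever defined; for estimates with unrelated conditionals the stated inequality can fail. *)

theory Defs
  imports "HOL-Probability.Probability"
begin

(* The input space is the type 'x::finite, the output space a set Y of reals, and the sources are
   indexed by the type 'k::finite, so that p = CARD('k) and weight vectors live in real ^ 'k.
   A distribution on the product of the input space and Y is a pmf supported in UNIV \<times> Y. *)

definition distribution_on :: "real set \<Rightarrow> ('x \<times> real) pmf \<Rightarrow> bool" where
  "distribution_on Y D \<longleftrightarrow> set_pmf D \<subseteq> UNIV \<times> Y"

definition marginal :: "('x \<times> real) pmf \<Rightarrow> 'x \<Rightarrow> real" where
  "marginal D x = pmf (map_pmf fst D) x"

definition cond_prob :: "('x \<times> real) pmf \<Rightarrow> real \<Rightarrow> 'x \<Rightarrow> real" where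
  "cond_prob D y x = pmf D (x, y) / marginal D x"

(* The conditional probabilities are compared only where both are defined, i.e. at inputs of
   positive marginal mass under both distributions; no relation between supports is implied.
   The condition is imposed on the sources and, separately, on their estimates. The latter cannot be
   dropped: with Y = {0..1}, L a y = max 0 (a + y - 1), inputs A, B, h 1 = (1, 0), h 2 = (0, 1),
   y uniform on {0, 1} under D 1 and D 2 with marginals (2e, 1 - 2e) and (1 - 2e, 2e), and estimates
   Dhat 1 = {(A,0): u/2, (A,1): u/2, (B,1): 1 - u} and Dhat 2 its image under swapping A and B, the
   target (Dhat 1 + Dhat 2) / 2 violates the bound for every choice of weights
   (e = 0.001, u = 0.1, delta = 0.005, alpha = 50). *)

definition common_conditional :: "('k \<Rightarrow> ('x \<times> real) pmf) \<Rightarrow> bool" where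
  "common_conditional D \<longleftrightarrow>
     (\<forall>i j x y. marginal (D i) x > 0 \<longrightarrow> marginal (D j) x > 0 \<longrightarrow>
        cond_prob (D i) y x = cond_prob (D j) y x)"

(* For a pmf, the Bochner expectation is the sum of pmf D (x, y) * L (h x) y. It is used below only
   for losses that are bounded on the support of D, so the convention that the integral of a
   non-integrable function is 0 plays no role. *)

definition expected_loss ::
  "(real \<Rightarrow> real \<Rightarrow> real) \<Rightarrow> ('x \<times> real) pmf \<Rightarrow> ('x \<Rightarrow> real) \<Rightarrow> real" where
  "expected_loss L D h = measure_pmf.expectation D (\<lambda>(x, y). L (h x) y)"

definition simplex_weights :: "(real ^ 'k) set" where
  "simplex_weights = {w. (\<forall>k. 0 \<le> w $ k) \<and> (\<Sum>k\<in>UNIV. w $ k) = 1}"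

definition dw_comb ::
  "('k::finite \<Rightarrow> ('x::finite \<times> real) pmf) \<Rightarrow> ('k \<Rightarrow> 'x \<Rightarrow> real) \<Rightarrow> real \<Rightarrow> real ^ 'k \<Rightarrow> 'x \<Rightarrow> real" where
  "dw_comb D h \<eta> z x =
     (\<Sum>k\<in>UNIV. (z $ k * marginal (D k) x + \<eta> * pmf (pmf_of_set UNIV) x / real CARD('k)) /
        ((\<Sum>j\<in>UNIV. z $ j * marginal (D j) x) + \<eta> * pmf (pmf_of_set UNIV) x) * h k x)"

(* Powers of extended nonnegative reals with a positive exponent. *)

definition ennreal_powr :: "ennreal \<Rightarrow> real \<Rightarrow> ennreal" where
  "ennreal_powr u a = (if u = \<infinity> then \<infinity> else ennreal (enn2real u powr a))"

definition exp_renyi :: "real \<Rightarrow> 'a pmf \<Rightarrow> 'a pmf \<Rightarrow> ennreal" where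
  "exp_renyi \<alpha> D D' =
     ennreal_powr
       (\<Sum>\<^sub>\<infinity>a\<in>UNIV. if pmf D a = 0 then 0
                 else if pmf D' a = 0 then \<infinity>
                 else ennreal (pmf D a powr \<alpha> / pmf D' a powr (\<alpha> - 1)))
       (1 / (\<alpha> - 1))"

definition exp_renyi_class :: "real \<Rightarrow> 'a pmf \<Rightarrow> 'a pmf set \<Rightarrow> ennreal" where
  "exp_renyi_class \<alpha> D C = (INF D'\<in>C. exp_renyi \<alpha> D D')"

definition mixtures :: "('k::finite \<Rightarrow> 'a pmf) \<Rightarrow> 'a pmf set" where
  "mixtures D = {Q. \<exists>w\<in>simplex_weights. \<forall>a. pmf Q a = (\<Sum>k\<in>UNIV. w $ k * pmf (D k) a)}"

(* Meaningful only when all the divergences involved are finite: enn2real \<infinity> = 0. *)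

definition eps_hat ::
  "real \<Rightarrow> real \<Rightarrow> real \<Rightarrow> ('k::finite \<Rightarrow> 'a pmf) \<Rightarrow> ('k \<Rightarrow> 'a pmf) \<Rightarrow> real" where
  "eps_hat \<alpha> \<epsilon> M Dhat D =
     Max (range (\<lambda>k. (\<epsilon> * enn2real (exp_renyi \<alpha> (Dhat k) (D k))) powr ((\<alpha> - 1) / \<alpha>) * M powr (1 / \<alpha>)))"

end

theory Submission
  imports Defs
begin

text \<open>
  Hoelder's inequality bounds the loss of a predictor under \<open>P\<close> by its loss under \<open>Q\<close> and
  \<open>exp_renyi \<alpha> P Q\<close>. Used from \<open>D k\<close> to \<open>Dhat k\<close>, it bounds
  \<open>E = max\<^sub>k expected_loss L (Dhat k) (h k)\<close> by \<open>eps_hat\<close> for every \<open>\<alpha>\<close>; since \<open>E\<close> itself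
  does not depend on \<open>\<alpha>\<close>, neither do the weights chosen for it. Brouwer's fixed point theorem gives
  weights \<open>z\<close> for which no loss on a \<open>Dhat k\<close> exceeds the loss on the \<open>z\<close>-mixture by more than
  \<open>\<delta> / 2\<close>, and by convexity the latter is at most \<open>E + \<delta> / 2\<close>. Hence the loss on every mixture
  of the \<open>Dhat k\<close> is at most \<open>E + \<delta>\<close>, and a second use of Hoelder's inequality transfers this bound
  to the target.
\<close>

section \<open>Hoelder's inequality and Renyi divergences\<close>

lemma Holder_integral:
  fixes f g :: "'a \<Rightarrow> real"
  assumes pq: "p > 1" "q > 1" "1 / p + 1 / q = 1"
    and [measurable]: "f \<in> borel_measurable M" "g \<in> borel_measurable M"
    and nonneg: "\<And>x. 0 \<le> f x" "\<And>x. 0 \<le> g x"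
    and int: "integrable M (\<lambda>x. f x powr p)" "integrable M (\<lambda>x. g x powr q)"
  shows "(\<integral>x. f x * g x \<partial>M)
    \<le> (\<integral>x. f x powr p \<partial>M) powr (1 / p) * (\<integral>x. g x powr q \<partial>M) powr (1 / q)"
proof -
  let ?A = "\<integral>x. f x powr p \<partial>M" and ?B = "\<integral>x. g x powr q \<partial>M"
  have A0: "0 \<le> ?A" and B0: "0 \<le> ?B"
    by simp_all
  show ?thesis
  proof (cases "?A = 0 \<or> ?B = 0")
    case True
    then have "AE x in M. f x * g x = 0"
    proof
      assume "?A = 0"
      then have "AE x in M. f x powr p = 0"
        using integral_nonneg_eq_0_iff_AE[OF int(1)] by simp
      then show ?thesis
        by eventually_elim simp
    next
      assume "?B = 0"
      then have "AE x in M. g x powr q = 0"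
        using integral_nonneg_eq_0_iff_AE[OF int(2)] by simp
      then show ?thesis
        by eventually_elim simp
    qed
    then have "(\<integral>x. f x * g x \<partial>M) = 0"
      using integral_cong_AE[of "\<lambda>x. f x * g x" M "\<lambda>x. 0"] by simp
    then show ?thesis
      by simp
  next
    case False
    \<comment> \<open>With both integrals positive, \<open>f\<close> and \<open>g\<close> are
      normalised by their norms \<open>a\<close> and \<open>b\<close>. Young's inequality for
      \<open>f x / a\<close> and \<open>g x / b\<close> then integrates to
      \<open>1 / p + 1 / q = 1\<close>.\<close>
    define a b where "a = ?A powr (1 / p)" and "b = ?B powr (1 / q)"
    have ab: "a > 0" "b > 0" "a powr p = ?A" "b powr q = ?B"
      using False A0 B0 pq by (auto simp: a_def b_def powr_powr)
    have "(\<integral>x. f x * g x \<partial>M)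
        \<le> (\<integral>x. a * b * (f x powr p / (p * ?A) + g x powr q / (q * ?B)) \<partial>M)"
    proof (rule integral_mono')
      show "integrable M (\<lambda>x. a * b * (f x powr p / (p * ?A) + g x powr q / (q * ?B)))"
        using int by simp
      fix x
      have "f x / a * (g x / b) \<le> (f x / a) powr p / p + (g x / b) powr q / q"
        using pq ab nonneg by (intro Youngs_inequality) auto
      also have "\<dots> = f x powr p / (p * ?A) + g x powr q / (q * ?B)"
        using ab nonneg by (simp add: powr_divide mult.commute)
      finally show "f x * g x \<le> a * b * (f x powr p / (p * ?A) + g x powr q / (q * ?B))"
        using ab(1,2) by (simp add: field_simps)
      show "0 \<le> a * b * (f x powr p / (p * ?A) + g x powr q / (q * ?B))"
        using ab(1,2) pq A0 B0 by simp
    qed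
    also have "\<dots> = a * b * (?A / (p * ?A) + ?B / (q * ?B))"
      using int by simp
    also have "\<dots> = a * b"
      using False pq by simp
    finally show ?thesis
      by (simp add: a_def b_def)
  qed
qed

text \<open>A finite divergence excludes every infinite term of the sum, which forces absolute
  continuity. The remaining terms are real, so the extended sum becomes an ordinary integral over
  the counting measure. Raising to the power \<open>\<alpha> - 1\<close> undoes the outer exponent
  in \<open>exp_renyi\<close>.\<close>

lemma exp_renyi_finiteD:
  assumes \<alpha>: "\<alpha> > 1" and fin: "exp_renyi \<alpha> P Q < \<infinity>"
  shows "set_pmf P \<subseteq> set_pmf Q"
    and "integrable (count_space UNIV) (\<lambda>a. pmf P a powr \<alpha> * pmf Q a powr (1 - \<alpha>))"
    and "(\<integral>a. pmf P a powr \<alpha> * pmf Q a powr (1 - \<alpha>) \<partial>count_space UNIV)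
      \<le> enn2real (exp_renyi \<alpha> P Q) powr (\<alpha> - 1)"
proof -
  define t where "t a = (if pmf P a = 0 then 0 else if pmf Q a = 0 then \<infinity>
      else ennreal (pmf P a powr \<alpha> / pmf Q a powr (\<alpha> - 1)))" for a
  define T where "T = infsum t UNIV"
  define g where "g a = pmf P a powr \<alpha> * pmf Q a powr (1 - \<alpha>)" for a
  have er: "exp_renyi \<alpha> P Q = ennreal_powr T (1 / (\<alpha> - 1))"
    unfolding exp_renyi_def T_def t_def ..
  have Tfin: "T \<noteq> \<infinity>"
    using fin by (auto simp: er ennreal_powr_def)
  \<comment> \<open>In \<open>ennreal\<close> the infinite sum is the supremum of its finite partial
    sums, so the finite \<open>T\<close> bounds each of them and hence each single term.\<close>
  have le: "sum t F \<le> T" if "finite F" for F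
    using that by (auto simp: T_def nonneg_infsum_complete intro!: SUP_upper)
  have tfin: "t a \<noteq> \<infinity>" for a
    using le[of "{a}"] Tfin by (auto simp: top_unique)
  show sub: "set_pmf P \<subseteq> set_pmf Q"
    using tfin by (fastforce simp: set_pmf_iff t_def split: if_splits)
  \<comment> \<open>Where \<open>pmf P a = 0\<close>, both sides are 0 because
    \<open>0 powr \<alpha> = 0\<close>. Elsewhere \<open>pmf Q a\<close> is positive by
    \<open>tfin\<close>, and only the sign of the exponent changes.\<close>
  have tg: "t a = ennreal (g a)" for a
    using tfin[of a] powr_minus[of "pmf Q a" "\<alpha> - 1"]
    by (auto simp: t_def g_def divide_inverse split: if_splits)
  have g0: "0 \<le> g a" for a
    by (simp add: g_def)
  have gle: "sum g F \<le> enn2real T" if "finite F" for F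
  proof -
    have "ennreal (sum g F) \<le> T"
      using le[OF that] g0 by (simp add: tg)
    then have "ennreal (sum g F) \<le> ennreal (enn2real T)"
      using Tfin by (simp add: less_top)
    then show ?thesis
      by (simp add: ennreal_le_iff)
  qed
  have sumg: "g summable_on UNIV"
    using g0 gle by (intro nonneg_bdd_above_summable_on bdd_aboveI[of _ "enn2real T"]) auto
  then have "(\<lambda>a. norm (g a)) summable_on UNIV"
    using g0 by simp
  then have abs: "Infinite_Set_Sum.abs_summable_on g UNIV"
    by (simp only: abs_summable_equivalent)
  then show "integrable (count_space UNIV) (\<lambda>a. pmf P a powr \<alpha> * pmf Q a powr (1 - \<alpha>))"
    by (simp add: Infinite_Set_Sum.abs_summable_on_def flip: g_def)
  have "(\<integral>a. g a \<partial>count_space UNIV) = infsum g UNIV"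
    using infsetsum_infsum[OF abs] by (simp add: infsetsum_def)
  also have "\<dots> \<le> enn2real T"
    using sumg gle by (intro infsum_le_finite_sums) auto
  also have "\<dots> = enn2real (exp_renyi \<alpha> P Q) powr (\<alpha> - 1)"
    using Tfin \<alpha> by (simp add: er ennreal_powr_def powr_powr)
  finally show "(\<integral>a. pmf P a powr \<alpha> * pmf Q a powr (1 - \<alpha>) \<partial>count_space UNIV)
      \<le> enn2real (exp_renyi \<alpha> P Q) powr (\<alpha> - 1)"
    by (simp add: g_def)
qed

lemma expectation_eq_integral_count_space:
  fixes f :: "'a \<Rightarrow> real"
  shows "measure_pmf.expectation P f = (\<integral>a. pmf P a * f a \<partial>count_space UNIV)"
  by (simp add: measure_pmf_eq_density integral_density)

lemma integrable_iff_integrable_count_space: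
  fixes f :: "'a \<Rightarrow> real"
  shows "integrable (measure_pmf P) f \<longleftrightarrow> integrable (count_space UNIV) (\<lambda>a. pmf P a * f a)"
  by (simp add: measure_pmf_eq_density integrable_real_density)

text \<open>Hoelder's inequality with exponents \<open>\<alpha>\<close> and
  \<open>\<alpha> / (\<alpha> - 1)\<close>. The factor carrying \<open>P\<close> yields the
  divergence. In the other factor the power of \<open>f\<close> is reduced to \<open>f\<close>
  itself at the price of a power of \<open>M\<close>, which leaves the expectation under
  \<open>Q\<close>.\<close>

lemma expectation_le_exp_renyi:
  fixes f :: "'a \<Rightarrow> real"
  assumes \<alpha>: "\<alpha> > 1" and fin: "exp_renyi \<alpha> P Q < \<infinity>"
    and f: "\<And>a. a \<in> set_pmf Q \<Longrightarrow> 0 \<le> f a" "\<And>a. a \<in> set_pmf Q \<Longrightarrow> f a \<le> M"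
  shows "measure_pmf.expectation P f
    \<le> (enn2real (exp_renyi \<alpha> P Q) * measure_pmf.expectation Q f) powr ((\<alpha> - 1) / \<alpha>)
       * M powr (1 / \<alpha>)"
proof -
  define \<beta> where "\<beta> = \<alpha> / (\<alpha> - 1)"
  have \<beta>: "\<beta> > 1" "1 / \<alpha> + 1 / \<beta> = 1" "\<alpha> / \<beta> = \<alpha> - 1" "\<beta> - 1 = \<beta> / \<alpha>" "1 / \<beta> = (\<alpha> - 1) / \<alpha>"
    using \<alpha> by (auto simp: \<beta>_def field_simps)
  \<comment> \<open>The bounds on \<open>f\<close> hold only on the support of \<open>Q\<close>.
    Cutting \<open>f\<close> off outside it makes them global and changes neither expectation, since
    the support of \<open>P\<close> lies inside that of \<open>Q\<close>.\<close>
  define f' where "f' a = (if a \<in> set_pmf Q then f a else 0)" for a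
  have M: "0 \<le> M"
    using f set_pmf_not_empty[of Q] by (meson ex_in_conv order_trans)
  have f': "0 \<le> f' a" "f' a \<le> M" for a
    using f M by (auto simp: f'_def)
  note D = exp_renyi_finiteD[OF \<alpha> fin]
  \<comment> \<open>The power of \<open>pmf Q a\<close> is split off so that
    \<open>u a powr \<alpha>\<close> is exactly the summand of the divergence (as
    \<open>\<alpha> / \<beta> = \<alpha> - 1\<close>) and \<open>v a powr \<beta>\<close> carries
    the single factor \<open>pmf Q a\<close>.\<close>
  define u v where "u a = pmf P a * pmf Q a powr (- (1 / \<beta>))"
    and "v a = pmf Q a powr (1 / \<beta>) * f' a" for a
  have uv: "pmf P a * f' a = u a * v a" for a
    using D(1) by (cases "pmf Q a = 0") (auto simp: u_def v_def powr_minus set_pmf_iff f'_def)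
  have u: "u a powr \<alpha> = pmf P a powr \<alpha> * pmf Q a powr (1 - \<alpha>)" for a
    using \<beta>(3) by (simp add: u_def powr_mult powr_powr)
  have v: "v a powr \<beta> = pmf Q a * f' a powr \<beta>" for a
    using \<beta>(1) by (simp add: v_def powr_mult powr_powr f')
  have v_le: "v a powr \<beta> \<le> M powr (\<beta> - 1) * (pmf Q a * f' a)" for a
  proof -
    have "f' a powr \<beta> = f' a powr (\<beta> - 1) * f' a"
      using f'(1)[of a] by (cases "f' a = 0") (auto simp: powr_diff)
    also have "\<dots> \<le> M powr (\<beta> - 1) * f' a"
      using f' \<beta> by (intro mult_right_mono powr_mono2) auto
    finally have "pmf Q a * f' a powr \<beta> \<le> pmf Q a * (M powr (\<beta> - 1) * f' a)"
      by (intro mult_left_mono) auto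
    then show ?thesis
      by (simp add: v mult_ac)
  qed
  have "integrable (measure_pmf Q) f'"
    using f' by (intro measure_pmf.integrable_const_bound[where B = M]) auto
  then have intQ: "integrable (count_space UNIV) (\<lambda>a. pmf Q a * f' a)"
    by (simp add: integrable_iff_integrable_count_space)
  have intv: "integrable (count_space UNIV) (\<lambda>a. v a powr \<beta>)"
    using v_le f'
    by (intro Bochner_Integration.integrable_bound
        [OF integrable_mult_right[OF intQ, of "M powr (\<beta> - 1)"]])
      (auto simp: abs_mult)
  have EP: "measure_pmf.expectation P f = (\<integral>a. u a * v a \<partial>count_space UNIV)"
  proof -
    have "measure_pmf.expectation P f = measure_pmf.expectation P f'"
      using D(1) by (intro integral_cong_AE) (auto simp: AE_measure_pmf_iff f'_def)
    then show ?thesis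
      by (simp add: expectation_eq_integral_count_space uv)
  qed
  have EQ: "(\<integral>a. pmf Q a * f' a \<partial>count_space UNIV) = measure_pmf.expectation Q f"
    unfolding expectation_eq_integral_count_space[symmetric]
    by (intro integral_cong_AE) (auto simp: AE_measure_pmf_iff f'_def)
  have EQ0: "0 \<le> measure_pmf.expectation Q f"
    unfolding EQ[symmetric] using f' by simp
  have "measure_pmf.expectation P f
      \<le> (\<integral>a. u a powr \<alpha> \<partial>count_space UNIV) powr (1 / \<alpha>)
        * (\<integral>a. v a powr \<beta> \<partial>count_space UNIV) powr (1 / \<beta>)"
    unfolding EP
  proof (rule Holder_integral)
    show "integrable (count_space UNIV) (\<lambda>a. u a powr \<alpha>)"
      using D(2) by (simp add: u)
    show "0 \<le> u a" "0 \<le> v a" for a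
      by (simp_all add: u_def v_def f')
  qed (use \<alpha> \<beta> intv in auto)
  also have "\<dots> \<le> (enn2real (exp_renyi \<alpha> P Q) powr (\<alpha> - 1)) powr (1 / \<alpha>)
        * (M powr (\<beta> - 1) * measure_pmf.expectation Q f) powr (1 / \<beta>)"
  proof (intro mult_mono powr_mono2)
    show "(\<integral>a. u a powr \<alpha> \<partial>count_space UNIV) \<le> enn2real (exp_renyi \<alpha> P Q) powr (\<alpha> - 1)"
      using D(3) by (simp add: u)
    have "(\<integral>a. v a powr \<beta> \<partial>count_space UNIV)
        \<le> (\<integral>a. M powr (\<beta> - 1) * (pmf Q a * f' a) \<partial>count_space UNIV)"
      using intv intQ v_le by (intro integral_mono) auto
    then show "(\<integral>a. v a powr \<beta> \<partial>count_space UNIV)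
        \<le> M powr (\<beta> - 1) * measure_pmf.expectation Q f"
      by (simp add: EQ)
  qed (use \<alpha> \<beta> in auto)
  also have "\<dots> = (enn2real (exp_renyi \<alpha> P Q) * measure_pmf.expectation Q f) powr ((\<alpha> - 1) / \<alpha>)
       * M powr (1 / \<alpha>)"
  proof -
    have "(\<beta> - 1) * (1 / \<beta>) = 1 / \<alpha>" "(\<alpha> - 1) * (1 / \<alpha>) = 1 / \<beta>"
      using \<alpha> by (simp_all add: \<beta>_def field_simps)
    then show ?thesis
      using EQ0 by (simp only: powr_mult powr_powr \<beta>(5)[symmetric] mult_ac)
  qed
  finally show ?thesis .
qed

section \<open>Densities and mixtures of discrete distributions\<close>

lemma integrable_measure_pmf_density:
  fixes f :: "'a \<Rightarrow> real"
  assumes "\<And>a. pmf P a = w a * pmf R a"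
  shows "integrable (measure_pmf P) f \<longleftrightarrow> integrable (measure_pmf R) (\<lambda>a. w a * f a)"
  by (simp add: integrable_iff_integrable_count_space assms mult_ac)

lemma expectation_density:
  fixes f :: "'a \<Rightarrow> real"
  assumes "\<And>a. pmf P a = w a * pmf R a"
  shows "measure_pmf.expectation P f = measure_pmf.expectation R (\<lambda>a. w a * f a)"
  by (simp add: expectation_eq_integral_count_space assms mult_ac)

lemma expectation_mixture:
  fixes f :: "'a \<Rightarrow> real"
  assumes "\<And>a. pmf Q a = (\<Sum>k\<in>A. w k * pmf (D k) a)"
    and "\<And>k. k \<in> A \<Longrightarrow> integrable (measure_pmf (D k)) f"
  shows "measure_pmf.expectation Q f = (\<Sum>k\<in>A. w k * measure_pmf.expectation (D k) f)"
proof -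
  have "integrable (count_space UNIV) (\<lambda>a. pmf (D k) a * f a)" if "k \<in> A" for k
    using assms(2)[OF that] by (simp add: integrable_iff_integrable_count_space)
  then show ?thesis
    by (simp add: expectation_eq_integral_count_space assms(1) sum_distrib_right mult.assoc
        Bochner_Integration.integral_sum)
qed

lemma marginal_nonneg: "0 \<le> marginal P x"
  by (simp add: marginal_def)

lemma pmf_eq_0_if_marginal_eq_0:
  assumes "marginal P x = 0"
  shows "pmf P (x, y) = 0"
  using assms by (force simp: marginal_def pmf_eq_0_set_pmf)

text \<open>Each \<open>D k\<close> factors into its marginal times one shared conditional, and so
  does the uniform mixture \<open>R\<close> with marginal \<open>r\<close>. The conditional cancels
  in the quotient, leaving a density that depends on the input alone.\<close>

lemma common_conditional_density:
  fixes D :: "'k::finite \<Rightarrow> ('x \<times> real) pmf"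
  assumes cc: "common_conditional D"
  defines "R \<equiv> bind_pmf (pmf_of_set UNIV) D"
  defines "r \<equiv> (\<lambda>x. (\<Sum>k\<in>UNIV. marginal (D k) x) / real CARD('k))"
  shows "pmf (D k) a = marginal (D k) (fst a) / r (fst a) * pmf R a"
proof (cases "marginal (D k) (fst a) = 0")
  case True
  then show ?thesis
    using pmf_eq_0_if_marginal_eq_0[of "D k" "fst a" "snd a"] by simp
next
  case False
  obtain x y where a: "a = (x, y)"
    by fastforce
  have mk: "marginal (D k) x > 0"
    using False marginal_nonneg[of "D k" x] by (simp add: a)
  \<comment> \<open>The shared conditional is read off from \<open>D k\<close>, whose marginal is
    positive at \<open>x\<close>. A source of marginal 0 at \<open>x\<close> has no mass there, so
    the factorisation holds for it with any \<open>c\<close>.\<close>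
  define c where "c = cond_prob (D k) y x"
  have c: "pmf (D j) (x, y) = marginal (D j) x * c" for j
  proof (cases "marginal (D j) x = 0")
    case True
    then show ?thesis
      by (simp add: pmf_eq_0_if_marginal_eq_0)
  next
    case False
    then have mj: "marginal (D j) x > 0"
      using marginal_nonneg[of "D j" x] by simp
    then have "c = cond_prob (D j) y x"
      using cc mk unfolding c_def common_conditional_def by blast
    then show ?thesis
      using mj by (simp add: cond_prob_def)
  qed
  have "pmf R (x, y) = (\<Sum>j\<in>UNIV. pmf (D j) (x, y)) / real CARD('k)"
    by (simp add: R_def pmf_bind integral_pmf_of_set)
  also have "\<dots> = r x * c"
    by (simp add: c r_def sum_distrib_right)
  finally have "pmf R (x, y) = r x * c" .
  moreover have "r x > 0"
    unfolding r_def using mk marginal_nonneg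
    by (intro divide_pos_pos sum_pos2[of _ k]) auto
  ultimately show ?thesis
    by (simp add: a c)
qed

section \<open>The weight simplex and Brouwer's theorem\<close>

lemma simplex_weights_compact_convex:
  "compact (simplex_weights :: (real ^ 'k) set)" "convex (simplex_weights :: (real ^ 'k) set)"
  "(simplex_weights :: (real ^ 'k::finite) set) \<noteq> {}"
proof -
  have "closed (simplex_weights :: (real ^ 'k) set)"
    unfolding simplex_weights_def
    by (intro closed_Collect_conj closed_Collect_all closed_Collect_le closed_Collect_eq
        continuous_intros)
  moreover have "simplex_weights \<subseteq> cbox 0 (1 :: real ^ 'k)"
  proof
    fix w :: "real ^ 'k" assume w: "w \<in> simplex_weights"
    then have "w $ k \<le> 1" for k
      using member_le_sum[of k UNIV "\<lambda>k. w $ k"] by (simp add: simplex_weights_def)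
    then show "w \<in> cbox 0 1"
      using w by (simp add: mem_box_cart simplex_weights_def)
  qed
  ultimately show "compact (simplex_weights :: (real ^ 'k) set)"
    by (meson bounded_cbox bounded_subset compact_eq_bounded_closed)
  show "convex (simplex_weights :: (real ^ 'k) set)"
    by (auto simp: convex_def simplex_weights_def sum.distrib simp flip: sum_distrib_left)
  have "(\<chi> k. 1 / real CARD('k)) \<in> (simplex_weights :: (real ^ 'k) set)"
    by (simp add: simplex_weights_def)
  then show "(simplex_weights :: (real ^ 'k::finite) set) \<noteq> {}"
    by blast
qed

text \<open>The map \<open>\<phi>\<close> reweights each coordinate in proportion to its loss, with
  \<open>\<delta>\<close> spread evenly and \<open>s\<close> as normaliser. At a fixed point
  \<open>z $ k * (s z - l k z) = \<delta> / CARD('k)\<close>, which is positive, so no loss reaches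
  \<open>s z\<close>.\<close>

lemma equalising_weights:
  fixes l :: "'k::finite \<Rightarrow> real ^ 'k \<Rightarrow> real"
  assumes cont: "\<And>k. continuous_on simplex_weights (l k)"
    and nonneg: "\<And>k z. z \<in> simplex_weights \<Longrightarrow> 0 \<le> l k z" and \<delta>: "\<delta> > 0"
  shows "\<exists>z\<in>simplex_weights. \<forall>k. l k z \<le> (\<Sum>j\<in>UNIV. z $ j * l j z) + \<delta>"
proof -
  define s where "s z = (\<Sum>j\<in>UNIV. z $ j * l j z) + \<delta>" for z
  define \<phi> :: "real ^ 'k \<Rightarrow> real ^ 'k"
    where "\<phi> z = (\<chi> k. (z $ k * l k z + \<delta> / real CARD('k)) / s z)" for z
  have s: "s z > 0" if "z \<in> simplex_weights" for z
    unfolding s_def using that nonneg \<delta>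
    by (intro add_nonneg_pos sum_nonneg mult_nonneg_nonneg) (auto simp: simplex_weights_def)
  have "continuous_on simplex_weights \<phi>"
    unfolding \<phi>_def s_def
    by (intro continuous_intros cont) (use s in \<open>force simp: s_def\<close>)
  moreover have "\<phi> \<in> simplex_weights \<rightarrow> simplex_weights"
  proof
    fix z :: "real ^ 'k" assume z: "z \<in> simplex_weights"
    have "(\<Sum>k\<in>UNIV. \<phi> z $ k) = s z / s z"
      by (simp add: \<phi>_def s_def sum.distrib flip: sum_divide_distrib)
    moreover have "0 \<le> \<phi> z $ k" for k
      using s[OF z] nonneg[OF z] z \<delta> by (simp add: \<phi>_def simplex_weights_def)
    ultimately show "\<phi> z \<in> simplex_weights"
      using s[OF z] by (simp add: simplex_weights_def)
  qed
  ultimately obtain z where z: "z \<in> simplex_weights" "\<phi> z = z"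
    using brouwer[OF simplex_weights_compact_convex] by metis
  have "l k z \<le> s z" for k
  proof -
    have "(z $ k * l k z + \<delta> / real CARD('k)) / s z = z $ k"
      using arg_cong[OF z(2), of "\<lambda>v. v $ k"] by (simp add: \<phi>_def)
    then have eq: "z $ k * l k z + \<delta> / real CARD('k) = z $ k * s z"
      using s[OF z(1)] by (simp add: field_simps)
    moreover have "\<delta> / real CARD('k) > 0"
      using \<delta> by simp
    \<comment> \<open>The strictness supplied by the smoothing term also excludes
      \<open>z $ k = 0\<close>, so the weight can be cancelled.\<close>
    ultimately have "z $ k * l k z < z $ k * s z"
      by linarith
    moreover have "0 \<le> z $ k"
      using z(1) by (simp add: simplex_weights_def)
    ultimately show ?thesis
      by (simp add: mult_less_cancel_left)
  qed
  then show ?thesis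
    using z(1) by (auto simp: s_def)
qed

section \<open>The distribution-weighted combination under a bounded convex loss\<close>

locale bounded_convex_loss =
  fixes Y :: "real set" and L :: "real \<Rightarrow> real \<Rightarrow> real" and M :: real
    and D :: "'k::finite \<Rightarrow> ('x::finite \<times> real) pmf" and h :: "'k \<Rightarrow> 'x \<Rightarrow> real"
  assumes Y_convex: "convex Y"
    and L_nonneg: "\<And>a y. a \<in> Y \<Longrightarrow> y \<in> Y \<Longrightarrow> 0 \<le> L a y"
    and L_convex: "\<And>y. y \<in> Y \<Longrightarrow> convex_on Y (\<lambda>a. L a y)"
    and L_continuous: "\<And>y. y \<in> Y \<Longrightarrow> continuous_on Y (\<lambda>a. L a y)"
    and D_supp: "\<And>k. distribution_on Y (D k)"
    and h_in: "\<And>k x. h k x \<in> Y"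
    and L_le: "\<And>k x y. y \<in> Y \<Longrightarrow> L (h k x) y \<le> M"
begin

definition dw_coeff :: "real \<Rightarrow> real ^ 'k \<Rightarrow> 'x \<Rightarrow> 'k \<Rightarrow> real" where
  "dw_coeff \<eta> z x k =
     (z $ k * marginal (D k) x + \<eta> / (real CARD('x) * real CARD('k))) /
        ((\<Sum>j\<in>UNIV. z $ j * marginal (D j) x) + \<eta> / real CARD('x))"

lemma dw_comb_eq: "dw_comb D h \<eta> z x = (\<Sum>k\<in>UNIV. dw_coeff \<eta> z x k * h k x)"
  by (simp add: dw_comb_def dw_coeff_def)

lemma mixture_marginal_nonneg:
  "z \<in> simplex_weights \<Longrightarrow> 0 \<le> (\<Sum>j\<in>UNIV. z $ j * marginal (D j) x)"
  by (auto simp: simplex_weights_def marginal_nonneg intro!: sum_nonneg mult_nonneg_nonneg)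

lemma dw_denominator_pos:
  assumes "z \<in> simplex_weights" "\<eta> > 0"
  shows "0 < (\<Sum>j\<in>UNIV. z $ j * marginal (D j) x) + \<eta> / real CARD('x)"
  using mixture_marginal_nonneg[OF assms(1)] assms(2) by (simp add: add_nonneg_pos)

lemma dw_coeff_nonneg: "z \<in> simplex_weights \<Longrightarrow> \<eta> > 0 \<Longrightarrow> 0 \<le> dw_coeff \<eta> z x k"
  using dw_denominator_pos[of z \<eta> x]
  by (simp add: dw_coeff_def simplex_weights_def marginal_nonneg)

lemma sum_dw_coeff:
  assumes "z \<in> simplex_weights" "\<eta> > 0"
  shows "(\<Sum>k\<in>UNIV. dw_coeff \<eta> z x k) = 1"
  using dw_denominator_pos[OF assms, of x]
  by (simp add: dw_coeff_def sum.distrib flip: sum_divide_distrib)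

lemma dw_comb_in:
  assumes "z \<in> simplex_weights" "\<eta> > 0"
  shows "dw_comb D h \<eta> z x \<in> Y"
  unfolding dw_comb_eq
  using convex_sum[OF _ Y_convex sum_dw_coeff[OF assms], where y = "\<lambda>k. h k x"]
    dw_coeff_nonneg[OF assms] h_in by simp

text \<open>Jensen's inequality: at each input the coefficients form a probability vector.\<close>

lemma L_dw_comb_le:
  assumes "z \<in> simplex_weights" "\<eta> > 0" "y \<in> Y"
  shows "L (dw_comb D h \<eta> z x) y \<le> (\<Sum>k\<in>UNIV. dw_coeff \<eta> z x k * L (h k x) y)"
  unfolding dw_comb_eq
  using convex_on_sum[OF _ _ L_convex[OF assms(3)] sum_dw_coeff[OF assms(1,2)], where y = "\<lambda>k. h k x"]
    dw_coeff_nonneg[OF assms(1,2)] h_in by simp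

lemma L_dw_comb_le_bound:
  assumes "z \<in> simplex_weights" "\<eta> > 0" "y \<in> Y"
  shows "L (dw_comb D h \<eta> z x) y \<le> M"
proof -
  have "L (dw_comb D h \<eta> z x) y \<le> (\<Sum>k\<in>UNIV. dw_coeff \<eta> z x k * M)"
    using L_le[OF assms(3)] dw_coeff_nonneg[OF assms(1,2)]
    by (intro order_trans[OF L_dw_comb_le[OF assms]] sum_mono mult_left_mono) auto
  then show ?thesis
    using sum_dw_coeff[OF assms(1,2)] by (simp flip: sum_distrib_right)
qed

text \<open>The smoothing keeps the denominator positive even at inputs without mass under the
  mixture, so the combination is a quotient of affine functions of \<open>z\<close> with no pole on
  the simplex.\<close>

lemma continuous_on_dw_comb:
  assumes "\<eta> > 0"
  shows "continuous_on simplex_weights (\<lambda>z. dw_comb D h \<eta> z x)"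
  unfolding dw_comb_eq dw_coeff_def
  by (intro continuous_intros) (metis dw_denominator_pos[OF _ assms] less_irrefl)

lemma snd_in_if_in_set_pmf: "distribution_on Y P \<Longrightarrow> a \<in> set_pmf P \<Longrightarrow> snd a \<in> Y"
  by (auto simp: distribution_on_def)

lemma integrable_loss:
  assumes "distribution_on Y P" "\<And>x. g x \<in> Y" "\<And>x y. y \<in> Y \<Longrightarrow> L (g x) y \<le> M"
  shows "integrable (measure_pmf P) (\<lambda>(x, y). L (g x) y)"
  using snd_in_if_in_set_pmf[OF assms(1)] assms(2,3) L_nonneg
  by (intro measure_pmf.integrable_const_bound[where B = M]) (force simp: AE_measure_pmf_iff)+

lemma expected_loss_nonneg:
  assumes "distribution_on Y P" "\<And>x. g x \<in> Y"
  shows "0 \<le> expected_loss L P g"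
  unfolding expected_loss_def using snd_in_if_in_set_pmf[OF assms(1)] assms(2) L_nonneg
  by (intro integral_nonneg_AE) (force simp: AE_measure_pmf_iff)

text \<open>Dominated convergence along sequences of weights: the losses converge pointwise by
  continuity of \<open>L\<close>, and the constant \<open>M\<close> dominates them all. This
  supplies the continuity that Brouwer's theorem requires.\<close>

lemma continuous_on_expected_loss_dw_comb:
  assumes \<eta>: "\<eta> > 0" and P: "distribution_on Y P"
  shows "continuous_on simplex_weights (\<lambda>z. expected_loss L P (dw_comb D h \<eta> z))"
  unfolding continuous_on_sequentially comp_def
proof (intro allI ballI impI, elim conjE)
  fix z :: "nat \<Rightarrow> real ^ 'k" and z0
  assume z0: "z0 \<in> simplex_weights" and z: "\<forall>n. z n \<in> simplex_weights" and lim: "z \<longlonglongrightarrow> z0"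
  have "(\<lambda>n. L (dw_comb D h \<eta> (z n) x) y) \<longlonglongrightarrow> L (dw_comb D h \<eta> z0 x) y" if "y \<in> Y" for x y
  proof -
    have "(\<lambda>n. dw_comb D h \<eta> (z n) x) \<longlonglongrightarrow> dw_comb D h \<eta> z0 x"
      using continuous_on_tendsto_compose[OF continuous_on_dw_comb[OF \<eta>] lim z0] z by simp
    then show ?thesis
      by (rule continuous_on_tendsto_compose[OF L_continuous[OF that]])
        (use z z0 dw_comb_in[OF _ \<eta>] in auto)
  qed
  then show "(\<lambda>n. expected_loss L P (dw_comb D h \<eta> (z n)))
      \<longlonglongrightarrow> expected_loss L P (dw_comb D h \<eta> z0)"
    unfolding expected_loss_def
    using snd_in_if_in_set_pmf[OF P] L_dw_comb_le_bound[OF _ \<eta>] L_nonneg dw_comb_in[OF _ \<eta>] z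
    by (intro integral_dominated_convergence[where w = "\<lambda>_. M"]) (force simp: AE_measure_pmf_iff)+
qed

text \<open>
  The denominator of the weights cancels against the mixture density up to the smoothing term, so the
  loss of the combination on the mixture is at most the mixture of the losses plus an error linear in
  \<^term>\<open>\<eta>\<close>. The common conditional is what makes the sources have densities depending
  on the input alone.
\<close>

lemma mixture_loss_dw_comb_le:
  assumes cc: "common_conditional D"
  obtains K where "0 \<le> K"
    and "\<And>\<eta> z. \<eta> > 0 \<Longrightarrow> z \<in> simplex_weights \<Longrightarrow>
      (\<Sum>k\<in>UNIV. z $ k * expected_loss L (D k) (dw_comb D h \<eta> z))
        \<le> (\<Sum>k\<in>UNIV. z $ k * expected_loss L (D k) (h k)) + \<eta> * K"
proof
  define R where "R = bind_pmf (pmf_of_set UNIV) D"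
  define r where "r x = (\<Sum>k\<in>UNIV. marginal (D k) x) / real CARD('k)" for x
  define w where "w k x = marginal (D k) x / r x" for k x
  \<comment> \<open>\<open>\<eta> * e a\<close> is the smoothing error at \<open>a\<close>: the mass
    \<open>\<eta> / CARD('x)\<close> times the loss bound \<open>M\<close>, taken relative to the
    density of \<open>R\<close>.\<close>
  define e where "e a = M / (real CARD('x) * r (fst a))" for a :: "'x \<times> real"
  have dens: "pmf (D k) a = w k (fst a) * pmf R a" for k a
    using common_conditional_density[OF cc] by (simp add: w_def r_def[abs_def] R_def)
  have r0: "0 \<le> r x" for x
    by (simp add: r_def sum_nonneg marginal_nonneg)
  have RY: "snd a \<in> Y" if "a \<in> set_pmf R" for a
    using that snd_in_if_in_set_pmf[OF D_supp] by (cases a) (auto simp: R_def)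
  have rpos: "r (fst a) > 0" if a: "a \<in> set_pmf R" for a
  proof -
    obtain k where "a \<in> set_pmf (D k)"
      using a by (auto simp: R_def)
    then have "w k (fst a) \<noteq> 0"
      using dens[of k a] by (auto simp: set_pmf_iff)
    then show ?thesis
      using r0[of "fst a"] by (auto simp: w_def less_le)
  qed
  have M0: "0 \<le> M"
    using RY L_nonneg[OF h_in] L_le set_pmf_not_empty[of R] by (meson ex_in_conv order_trans)
  \<comment> \<open>This fixes \<open>K\<close> as the expectation of \<open>e\<close> before
    \<open>\<eta>\<close> and \<open>z\<close> are introduced, so it cannot depend on them.\<close>
  show "0 \<le> measure_pmf.expectation R e"
    using M0 r0 by (simp add: e_def)
  \<comment> \<open>\<open>e\<close> depends on the input alone and the input space is finite, hence
    \<open>e\<close> is bounded.\<close>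
  have "finite (range e)"
    by (rule finite_subset[of _ "range (\<lambda>x. M / (real CARD('x) * r x))"]) (auto simp: e_def)
  then have "e a \<le> Max (range e)" for a
    by simp
  moreover have "0 \<le> e a" for a
    using M0 r0 by (simp add: e_def)
  ultimately have inte: "integrable (measure_pmf R) e"
    by (intro measure_pmf.integrable_const_bound[where B = "Max (range e)"]) auto
  fix \<eta> :: real and z :: "real ^ 'k"
  assume \<eta>: "\<eta> > 0" and z: "z \<in> simplex_weights"
  let ?g = "dw_comb D h \<eta> z"
  have int1: "integrable (measure_pmf R) (\<lambda>a. w k (fst a) * L (?g (fst a)) (snd a))" for k
    using integrable_loss[OF D_supp, of ?g] dw_comb_in[OF z \<eta>] L_dw_comb_le_bound[OF z \<eta>]
    by (subst integrable_measure_pmf_density[OF dens, symmetric]) (simp add: case_prod_unfold)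
  have int2: "integrable (measure_pmf R) (\<lambda>a. w k (fst a) * L (h k (fst a)) (snd a))" for k
    using integrable_loss[OF D_supp, of "h k"] h_in L_le
    by (subst integrable_measure_pmf_density[OF dens, symmetric]) (simp add: case_prod_unfold)
  have "(\<Sum>k\<in>UNIV. z $ k * expected_loss L (D k) ?g)
      = measure_pmf.expectation R (\<lambda>a. \<Sum>k\<in>UNIV. z $ k * (w k (fst a) * L (?g (fst a)) (snd a)))"
    using int1 by (simp add: expected_loss_def case_prod_unfold expectation_density[OF dens])
  also have "\<dots> \<le> measure_pmf.expectation R
      (\<lambda>a. (\<Sum>k\<in>UNIV. z $ k * (w k (fst a) * L (h k (fst a)) (snd a))) + \<eta> * e a)"
  proof (rule integral_mono_AE)
    show "AE a in measure_pmf R. (\<Sum>k\<in>UNIV. z $ k * (w k (fst a) * L (?g (fst a)) (snd a)))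
        \<le> (\<Sum>k\<in>UNIV. z $ k * (w k (fst a) * L (h k (fst a)) (snd a))) + \<eta> * e a"
      unfolding AE_measure_pmf_iff
    proof
      fix a assume a: "a \<in> set_pmf R"
      obtain x y where xy: "a = (x, y)"
        by fastforce
      have y: "y \<in> Y" and rx: "r x > 0"
        using RY[OF a] rpos[OF a] by (simp_all add: xy)
      define s where "s = (\<Sum>k\<in>UNIV. z $ k * marginal (D k) x)"
      define u where "u = \<eta> / real CARD('x)"
      have s0: "0 \<le> s" and u0: "0 < u"
        using mixture_marginal_nonneg[OF z] \<eta> by (simp_all add: s_def u_def)
      have "s * L (?g x) y \<le> s * (\<Sum>k\<in>UNIV. dw_coeff \<eta> z x k * L (h k x) y)"
        using L_dw_comb_le[OF z \<eta> y] s0 by (intro mult_left_mono)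
      \<comment> \<open>Enlarging \<open>s\<close> to \<open>s + u\<close>, the common denominator
        of the coefficients, cancels that denominator and leaves only their numerators.\<close>
      also have "\<dots> \<le> (s + u) * (\<Sum>k\<in>UNIV. dw_coeff \<eta> z x k * L (h k x) y)"
        using u0 dw_coeff_nonneg[OF z \<eta>] L_nonneg[OF h_in y]
        by (intro mult_right_mono sum_nonneg mult_nonneg_nonneg) auto
      also have "\<dots> = (\<Sum>k\<in>UNIV. (z $ k * marginal (D k) x + u / real CARD('k)) * L (h k x) y)"
      proof -
        have "\<eta> / (real CARD('x) * real CARD('k)) = u / real CARD('k)"
          by (simp add: u_def)
        then show ?thesis
          using s0 u0 by (simp add: dw_coeff_def sum_distrib_left flip: s_def u_def)
      qed
      also have "\<dots> = (\<Sum>k\<in>UNIV. z $ k * marginal (D k) x * L (h k x) y)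
          + u / real CARD('k) * (\<Sum>k\<in>UNIV. L (h k x) y)"
        by (simp add: distrib_right sum.distrib sum_distrib_left)
      also have "\<dots> \<le> (\<Sum>k\<in>UNIV. z $ k * marginal (D k) x * L (h k x) y)
          + u / real CARD('k) * (\<Sum>k\<in>(UNIV :: 'k set). M)"
        using u0 L_le[OF y] by (intro add_left_mono mult_left_mono sum_mono) auto
      finally have "s * L (?g x) y / r x
          \<le> ((\<Sum>k\<in>UNIV. z $ k * marginal (D k) x * L (h k x) y) + u * M) / r x"
        using rx by (intro divide_right_mono) auto
      then show "(\<Sum>k\<in>UNIV. z $ k * (w k (fst a) * L (?g (fst a)) (snd a)))
          \<le> (\<Sum>k\<in>UNIV. z $ k * (w k (fst a) * L (h k (fst a)) (snd a))) + \<eta> * e a"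
        by (simp add: xy w_def e_def s_def u_def sum_divide_distrib sum_distrib_right
            sum_distrib_left add_divide_distrib mult_ac)
    qed
  qed (use int1 int2 inte in auto)
  also have "\<dots> = (\<Sum>k\<in>UNIV. z $ k * expected_loss L (D k) (h k))
      + \<eta> * measure_pmf.expectation R e"
    using int2 inte by (simp add: expected_loss_def case_prod_unfold expectation_density[OF dens])
  finally show "(\<Sum>k\<in>UNIV. z $ k * expected_loss L (D k) ?g)
      \<le> (\<Sum>k\<in>UNIV. z $ k * expected_loss L (D k) (h k)) + \<eta> * measure_pmf.expectation R e" .
qed

text \<open>Since the error constant \<open>K\<close> is uniform in the weights,
  \<open>\<eta>\<close> can be fixed first and the equalising weights found for the resulting family
  of combinations. Smoothing and equalising each use half of \<open>\<delta>\<close>.\<close>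

lemma robust_weights:
  assumes cc: "common_conditional D" and E: "\<And>k. expected_loss L (D k) (h k) \<le> E"
    and \<delta>: "\<delta> > 0"
  shows "\<exists>\<eta>>0. \<exists>z\<in>simplex_weights. \<forall>k. expected_loss L (D k) (dw_comb D h \<eta> z) \<le> E + \<delta>"
proof -
  obtain K where K: "0 \<le> K" and mix: "\<And>\<eta> z. \<eta> > 0 \<Longrightarrow> z \<in> simplex_weights \<Longrightarrow>
      (\<Sum>k\<in>UNIV. z $ k * expected_loss L (D k) (dw_comb D h \<eta> z))
        \<le> (\<Sum>k\<in>UNIV. z $ k * expected_loss L (D k) (h k)) + \<eta> * K"
    using mixture_loss_dw_comb_le[OF cc] by blast
  \<comment> \<open>Taking \<open>K + 1\<close> rather than \<open>K\<close> keeps the quotient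
    positive when \<open>K = 0\<close>.\<close>
  define \<eta> where "\<eta> = \<delta> / (2 * (K + 1))"
  have \<eta>: "\<eta> > 0" "\<eta> * K \<le> \<delta> / 2"
    using K \<delta> by (auto simp: \<eta>_def field_simps)
  obtain z where z: "z \<in> simplex_weights"
    and le: "\<And>k. expected_loss L (D k) (dw_comb D h \<eta> z)
      \<le> (\<Sum>j\<in>UNIV. z $ j * expected_loss L (D j) (dw_comb D h \<eta> z)) + \<delta> / 2"
    using equalising_weights[of "\<lambda>k z. expected_loss L (D k) (dw_comb D h \<eta> z)" "\<delta> / 2"]
      continuous_on_expected_loss_dw_comb[OF \<eta>(1) D_supp]
      expected_loss_nonneg[OF D_supp] dw_comb_in[OF _ \<eta>(1)] \<delta> by auto
  have "(\<Sum>j\<in>UNIV. z $ j * expected_loss L (D j) (dw_comb D h \<eta> z))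
      \<le> (\<Sum>k\<in>UNIV. z $ k * expected_loss L (D k) (h k)) + \<eta> * K"
    by (rule mix[OF \<eta>(1) z])
  also have "\<dots> \<le> (\<Sum>k\<in>UNIV. z $ k * E) + \<delta> / 2"
    using z E \<eta> by (intro add_mono sum_mono mult_left_mono) (auto simp: simplex_weights_def)
  also have "\<dots> = E + \<delta> / 2"
    using z by (simp add: simplex_weights_def flip: sum_distrib_right)
  finally have "expected_loss L (D k) (dw_comb D h \<eta> z) \<le> E + \<delta>" for k
    using le[of k] by simp
  then show ?thesis
    using \<eta>(1) z by blast
qed

text \<open>For a fixed predictor the expected loss is linear in the distribution, so a bound at the
  vertices extends to their convex hull.\<close>

lemma expected_loss_mixture_le:
  assumes "Q \<in> mixtures D" "\<And>x. g x \<in> Y" "\<And>x y. y \<in> Y \<Longrightarrow> L (g x) y \<le> M"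
    and "\<And>k. expected_loss L (D k) g \<le> C"
  shows "expected_loss L Q g \<le> C"
proof -
  obtain w where w: "w \<in> simplex_weights" "\<And>a. pmf Q a = (\<Sum>k\<in>UNIV. w $ k * pmf (D k) a)"
    using assms(1) by (auto simp: mixtures_def)
  have "expected_loss L Q g = (\<Sum>k\<in>UNIV. w $ k * expected_loss L (D k) g)"
    unfolding expected_loss_def using integrable_loss[OF D_supp assms(2,3)]
    by (intro expectation_mixture w(2)) auto
  also have "\<dots> \<le> (\<Sum>k\<in>UNIV. w $ k * C)"
    using w(1) assms(4) by (intro sum_mono mult_left_mono) (auto simp: simplex_weights_def)
  also have "\<dots> = C"
    using w(1) by (simp add: simplex_weights_def flip: sum_distrib_right)
  finally show ?thesis .
qed

lemma distribution_on_mixture: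
  assumes "Q \<in> mixtures D"
  shows "distribution_on Y Q"
proof -
  obtain w where w: "\<And>a. pmf Q a = (\<Sum>k\<in>UNIV. w $ k * pmf (D k) a)"
    using assms by (auto simp: mixtures_def)
  have "\<exists>k. a \<in> set_pmf (D k)" if "a \<in> set_pmf Q" for a
  proof (rule ccontr)
    assume "\<nexists>k. a \<in> set_pmf (D k)"
    then have "pmf Q a = 0"
      by (simp add: w set_pmf_iff)
    then show False
      using that by (simp add: set_pmf_iff)
  qed
  then show ?thesis
    using D_supp by (fastforce simp: distribution_on_def)
qed

end

section \<open>Transfer to the target distribution\<close>

lemma expected_loss_le_exp_renyi:
  assumes "\<alpha> > 1" "exp_renyi \<alpha> P Q < \<infinity>" "distribution_on Y Q"
    and "\<And>x y. y \<in> Y \<Longrightarrow> 0 \<le> L (g x) y" "\<And>x y. y \<in> Y \<Longrightarrow> L (g x) y \<le> M"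
    and "expected_loss L Q g \<le> C"
  shows "expected_loss L P g
    \<le> (C * enn2real (exp_renyi \<alpha> P Q)) powr ((\<alpha> - 1) / \<alpha>) * M powr (1 / \<alpha>)"
proof -
  have Y: "snd a \<in> Y" if "a \<in> set_pmf Q" for a
    using that assms(3) by (auto simp: distribution_on_def)
  have "expected_loss L P g
    \<le> (enn2real (exp_renyi \<alpha> P Q) * expected_loss L Q g) powr ((\<alpha> - 1) / \<alpha>) * M powr (1 / \<alpha>)"
    unfolding expected_loss_def using assms(1,2,4,5) Y
    by (intro expectation_le_exp_renyi) auto
  also have "\<dots> \<le> (enn2real (exp_renyi \<alpha> P Q) * C) powr ((\<alpha> - 1) / \<alpha>) * M powr (1 / \<alpha>)"
  proof (intro mult_right_mono powr_mono2 mult_left_mono)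
    have "0 \<le> expected_loss L Q g"
      unfolding expected_loss_def using assms(4) Y
      by (intro integral_nonneg_AE) (force simp: AE_measure_pmf_iff)
    then show "0 \<le> enn2real (exp_renyi \<alpha> P Q) * expected_loss L Q g"
      by simp
  qed (use assms in auto)
  finally show ?thesis
    by (simp add: mult.commute)
qed

text \<open>To avoid asking whether the infimum is attained, the bound is applied to members of the
  class with divergence below \<open>d + 1 / Suc n\<close>, and \<open>n\<close> tends to
  infinity.\<close>

lemma expected_loss_le_exp_renyi_class:
  assumes \<alpha>: "\<alpha> > 1" and fin: "exp_renyi_class \<alpha> P \<C> < \<infinity>"
    and Q: "\<And>Q. Q \<in> \<C> \<Longrightarrow> distribution_on Y Q" "\<And>Q. Q \<in> \<C> \<Longrightarrow> expected_loss L Q g \<le> C"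
    and L: "\<And>x y. y \<in> Y \<Longrightarrow> 0 \<le> L (g x) y" "\<And>x y. y \<in> Y \<Longrightarrow> L (g x) y \<le> M"
    and C: "0 \<le> C"
  shows "expected_loss L P g
    \<le> (C * enn2real (exp_renyi_class \<alpha> P \<C>)) powr ((\<alpha> - 1) / \<alpha>) * M powr (1 / \<alpha>)"
proof -
  define d where "d = enn2real (exp_renyi_class \<alpha> P \<C>)"
  have d: "exp_renyi_class \<alpha> P \<C> = ennreal d" "0 \<le> d"
    using fin by (simp_all add: d_def)
  have "expected_loss L P g \<le> (C * (d + 1 / real (Suc n))) powr ((\<alpha> - 1) / \<alpha>) * M powr (1 / \<alpha>)"
    for n
  proof -
    define t where "t = d + 1 / real (Suc n)"
    have t: "d < t"
      by (simp add: t_def)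
    then have "exp_renyi_class \<alpha> P \<C> < ennreal t"
      using d by (simp add: ennreal_less_iff)
    then obtain Q where Q': "Q \<in> \<C>" "exp_renyi \<alpha> P Q < ennreal t"
      by (auto simp: exp_renyi_class_def INF_less_iff)
    then have fin: "exp_renyi \<alpha> P Q < \<infinity>"
      using less_trans[OF _ ennreal_less_top] by simp
    have "enn2real (exp_renyi \<alpha> P Q) \<le> t"
      using Q'(2) t d(2) by (intro enn2real_leI) auto
    then have "(C * enn2real (exp_renyi \<alpha> P Q)) powr ((\<alpha> - 1) / \<alpha>) * M powr (1 / \<alpha>)
        \<le> (C * t) powr ((\<alpha> - 1) / \<alpha>) * M powr (1 / \<alpha>)"
      using C \<alpha> by (intro mult_right_mono powr_mono2 mult_left_mono) auto
    with expected_loss_le_exp_renyi[OF \<alpha> fin Q(1)[OF Q'(1)], of L g M C] L Q(2)[OF Q'(1)]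
    show ?thesis
      by (force simp: t_def)
  qed
  \<comment> \<open>The base may be 0 when \<open>C = 0\<close>; the power is still continuous there
    because the exponent is positive and the bases are nonnegative.\<close>
  moreover have "(\<lambda>n. (C * (d + 1 / real (Suc n))) powr ((\<alpha> - 1) / \<alpha>) * M powr (1 / \<alpha>))
      \<longlonglongrightarrow> (C * (d + 0)) powr ((\<alpha> - 1) / \<alpha>) * M powr (1 / \<alpha>)"
    using \<alpha> C d(2) lim_inverse_n'[THEN LIMSEQ_Suc]
    by (intro tendsto_mult tendsto_const tendsto_powr' tendsto_add) auto
  ultimately show ?thesis
    unfolding d_def[symmetric] by (intro LIMSEQ_le_const) auto
qed

theorem theorem5:
  fixes Y :: "real set"
    and L :: "real \<Rightarrow> real \<Rightarrow> real"
    and D Dhat :: "'k::finite \<Rightarrow> ('x::finite \<times> real) pmf"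
    and h :: "'k \<Rightarrow> 'x \<Rightarrow> real"
    and D\<^sub>T :: "('x \<times> real) pmf"
    and \<epsilon> M :: real
  assumes "convex Y"
    and "\<And>a y. a \<in> Y \<Longrightarrow> y \<in> Y \<Longrightarrow> 0 \<le> L a y"
    and "\<And>y. y \<in> Y \<Longrightarrow> convex_on Y (\<lambda>a. L a y)"
    and "continuous_on (Y \<times> Y) (\<lambda>(a, y). L a y)"
    and "\<And>k. distribution_on Y (D k)"
    and "\<And>k. distribution_on Y (Dhat k)"
    and "distribution_on Y D\<^sub>T"
    and "\<And>k x. h k x \<in> Y"
    and "\<epsilon> > 0" and "M \<ge> 0"
    and "\<And>k. expected_loss L (D k) (h k) \<le> \<epsilon>"
    and "\<And>k x y. y \<in> Y \<Longrightarrow> L (h k x) y \<le> M"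
    and "common_conditional D"
    and "common_conditional Dhat"
  shows "\<forall>\<delta>>0. \<exists>\<eta>>0. \<exists>z\<in>simplex_weights. \<forall>\<alpha>>1.
           (\<forall>k. exp_renyi \<alpha> (Dhat k) (D k) < \<infinity>) \<longrightarrow>
           exp_renyi_class \<alpha> D\<^sub>T (mixtures Dhat) < \<infinity> \<longrightarrow>
           expected_loss L D\<^sub>T (dw_comb Dhat h \<eta> z)
             \<le> ((eps_hat \<alpha> \<epsilon> M Dhat D + \<delta>)
                 * enn2real (exp_renyi_class \<alpha> D\<^sub>T (mixtures Dhat))) powr ((\<alpha> - 1) / \<alpha>)
               * M powr (1 / \<alpha>)"
proof (intro allI impI)
  fix \<delta> :: real assume \<delta>: "\<delta> > 0"
  have "continuous_on Y (\<lambda>a. L a y)" if "y \<in> Y" for y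
    using continuous_on_compose2[OF assms(4), of Y "\<lambda>a. (a, y)"] that
    by (simp add: image_subset_iff continuous_on_Pair continuous_on_id continuous_on_const)
  \<comment> \<open>The estimates take the role of \<open>D\<close>, because both the combination
    and the mixtures are formed from them.\<close>
  then interpret bounded_convex_loss Y L M Dhat h
    using assms by unfold_locales auto
  \<comment> \<open>The weights must serve every \<open>\<alpha>\<close> at once, so they are chosen
    for this level and not for \<open>eps_hat\<close>, which varies with
    \<open>\<alpha>\<close>.\<close>
  define E where "E = Max (range (\<lambda>k. expected_loss L (Dhat k) (h k)))"
  have E: "expected_loss L (Dhat k) (h k) \<le> E" for k
    by (simp add: E_def)
  obtain \<eta> z where \<eta>: "\<eta> > 0" and z: "z \<in> simplex_weights"
    and loss: "\<And>k. expected_loss L (Dhat k) (dw_comb Dhat h \<eta> z) \<le> E + \<delta>"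
    using robust_weights[OF assms(14) E \<delta>] by blast
  note g = dw_comb_in[OF z \<eta>] L_dw_comb_le_bound[OF z \<eta>]
  have "expected_loss L D\<^sub>T (dw_comb Dhat h \<eta> z)
      \<le> ((eps_hat \<alpha> \<epsilon> M Dhat D + \<delta>)
          * enn2real (exp_renyi_class \<alpha> D\<^sub>T (mixtures Dhat))) powr ((\<alpha> - 1) / \<alpha>) * M powr (1 / \<alpha>)"
    if \<alpha>: "\<alpha> > 1" and fin: "\<forall>k. exp_renyi \<alpha> (Dhat k) (D k) < \<infinity>"
      "exp_renyi_class \<alpha> D\<^sub>T (mixtures Dhat) < \<infinity>" for \<alpha>
  proof (rule expected_loss_le_exp_renyi_class[where Y = Y, OF \<alpha> fin(2)])
    have "expected_loss L (Dhat k) (h k) \<le> eps_hat \<alpha> \<epsilon> M Dhat D" for k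
    proof -
      \<comment> \<open>The first change of measure: the bound \<open>\<epsilon>\<close> under the
        true source \<open>D k\<close> is carried over to its estimate.\<close>
      have "expected_loss L (Dhat k) (h k)
          \<le> (\<epsilon> * enn2real (exp_renyi \<alpha> (Dhat k) (D k))) powr ((\<alpha> - 1) / \<alpha>) * M powr (1 / \<alpha>)"
        using \<alpha> fin(1) assms by (intro expected_loss_le_exp_renyi[where Y = Y]) auto
      also have "\<dots> \<le> eps_hat \<alpha> \<epsilon> M Dhat D"
        unfolding eps_hat_def by (intro Max_ge) auto
      finally show ?thesis .
    qed
    then have "E \<le> eps_hat \<alpha> \<epsilon> M Dhat D"
      by (simp add: E_def)
    then have C: "expected_loss L (Dhat k) (dw_comb Dhat h \<eta> z) \<le> eps_hat \<alpha> \<epsilon> M Dhat D + \<delta>" for k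
      using loss[of k] by simp
    then show "expected_loss L Q (dw_comb Dhat h \<eta> z) \<le> eps_hat \<alpha> \<epsilon> M Dhat D + \<delta>"
      if "Q \<in> mixtures Dhat" for Q
      using expected_loss_mixture_le[OF that g] by simp
    show "0 \<le> eps_hat \<alpha> \<epsilon> M Dhat D + \<delta>"
      using order_trans[OF expected_loss_nonneg C] assms(6) g(1) by simp
  qed (use g assms distribution_on_mixture in auto)
  then show "\<exists>\<eta>>0. \<exists>z\<in>simplex_weights. \<forall>\<alpha>>1.
           (\<forall>k. exp_renyi \<alpha> (Dhat k) (D k) < \<infinity>) \<longrightarrow>
           exp_renyi_class \<alpha> D\<^sub>T (mixtures Dhat) < \<infinity> \<longrightarrow>
           expected_loss L D\<^sub>T (dw_comb Dhat h \<eta> z)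
             \<le> ((eps_hat \<alpha> \<epsilon> M Dhat D + \<delta>)
                 * enn2real (exp_renyi_class \<alpha> D\<^sub>T (mixtures Dhat))) powr ((\<alpha> - 1) / \<alpha>)
               * M powr (1 / \<alpha>)"
    using \<eta> z by blast
qed

end
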